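(* Let $(A,\varrho_A,[\cdot,\cdot])$ be a skew-symmetric algebroid over a manifold $M$ equipped with a pseudo-Riemannian metric $g\in\Gamma(\mathsf{S}^2A^* )$ in $A$ and a symmetric bracket $\langle\cdot:\cdot\rangle:\Gamma(A)\times\Gamma(A)\to\Gamma(A)$. Let $T\in\Gamma(\bigwedge^2A^*\otimes A)$ and let $\nabla$ be the $A$-connection in $A$ given by $$\nabla_XY=\tfrac12\big([X,Y]+\langle X:Y\rangle\big)+\tfrac12T(X,Y)$$ for $X,Y\in\Gamma(A)$ (so that $T$ is the torsion of $\nabla$), and suppose that $\nabla$ has totally skew-symmetric torsion with respect to $g$. Then $\nabla$ is metric with respect to $g$ (i.e. $\nabla g=0$) if and only if $$\mathcal{L}^a_Xg=-\mathcal{L}^s_Xg$$ for every $X\in\Gamma(A)$.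
   Context: A skew-symmetric algebroid $(A,\varrho_A,[\cdot,\cdot])$ over $M$ is a vector bundle $A\to M$ with a vector bundle homomorphism $\varrho_A:A\to TM$ over the identity (anchor) and an $\mathbb{R}$-bilinear skew-symmetric map $[\cdot,\cdot]:\Gamma(A)\times\Gamma(A)\to\Gamma(A)$ with $[X,fY]=f[X,Y]+(\varrho_A\circ X)(f)\,Y$ for $X,Y\in\Gamma(A)$, $f\in C^\infty(M)$ (no Jacobi identity is assumed, and the anchor need not preserve brackets). A symmetric bracket is an $\mathbb{R}$-bilinear symmetric map $\langle\cdot:\cdot\rangle:\Gamma(A)\times\Gamma(A)\to\Gamma(A)$ with $\langle X:fY\rangle=f\langle X:Y\rangle+(\varrho_A\circ X)(f)Y$. An $A$-connection in $A$ is an $\mathbb{R}$-bilinear map $\nabla:\Gamma(A)\times\Gamma(A)\to\Gamma(A)$ with $\nabla_{fX}Y=f\nabla_XY$ and $\nabla_X(fY)=f\nabla_XY+(\varrho_A\circ X)(f)Y$. Its torsion is $T^\nabla(X,Y)=\nabla_XY-\nabla_YX-[X,Y]$; it is totally skew-symmetric with respect to $g$ if $(X,Y,Z)\mapsto g(T^\nabla(X,Y),Z)$ is a $3$-form, i.e. in $\Gamma(\bigwedge^3A^* )$. A pseudo-Riemannian metric $g$ in $A$ is a nondegenerate section of $\mathsf{S}^2A^*$, and $(\nabla g)(X,Y,Z)=(\varrho_A\circ X)(g(Y,Z))-g(\nabla_XY,Z)-g(Y,\nabla_XZ)$. The alternating and the symmetric Lie derivatives of $g$ are $(\mathcal{L}^a_Xg)(Y,Z)=(\varrho_A\circ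 X)(g(Y,Z))-g([X,Y],Z)-g(Y,[X,Z])$ and $(\mathcal{L}^s_Xg)(Y,Z)=(\varrho_A\circ X)(g(Y,Z))-g(\langle X:Y\rangle,Z)-g(Y,\langle X:Z\rangle)$. *)

theory Defs
  imports "HOL-Analysis.Analysis" "HOL-Library.Function_Algebras"
begin

(* Sections of bundles and tangent vectors are functions; they carry the pointwise
   vector space structure. *)

instantiation "fun" :: (type, real_vector) real_vector
begin

definition scaleR_fun :: "real \<Rightarrow> ('a \<Rightarrow> 'b) \<Rightarrow> 'a \<Rightarrow> 'b"
  where "scaleR_fun c f = (\<lambda>x. c *\<^sub>R f x)"

instance
  by standard (auto simp: scaleR_fun_def plus_fun_def scaleR_add_right scaleR_add_left)

end

definition linear_on :: "'v::real_vector set \<Rightarrow> ('v \<Rightarrow> 'w::real_vector) \<Rightarrow> bool"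
  where "linear_on S f \<longleftrightarrow>
    (\<forall>x\<in>S. \<forall>y\<in>S. f (x + y) = f x + f y) \<and> (\<forall>c. \<forall>x\<in>S. f (c *\<^sub>R x) = c *\<^sub>R f x)"


section \<open>Smooth functions on open subsets of Euclidean space\<close>

(* R^n is the library's Euclidean_space n: the sequences x with x i = 0 for i \<ge> n. This
   includes n = 0 (manifolds of dimension 0 and bundles of rank 0). The sets W below are
   open in R^n; W is in general not open in the type nat \<Rightarrow> real. *)

definition partial_deriv :: "nat \<Rightarrow> ((nat \<Rightarrow> real) \<Rightarrow> real) \<Rightarrow> (nat \<Rightarrow> real) \<Rightarrow> real"
  where "partial_deriv i f x = deriv (\<lambda>t. f (x(i := t))) (x i)"

primrec Ck_on :: "nat \<Rightarrow> (nat \<Rightarrow> real) set \<Rightarrow> nat \<Rightarrow> ((nat \<Rightarrow> real) \<Rightarrow> real) \<Rightarrow> bool"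
  where
    "Ck_on n W 0 f \<longleftrightarrow> continuous_on W f"
  | "Ck_on n W (Suc k) f \<longleftrightarrow> continuous_on W f \<and>
      (\<forall>i<n. (\<forall>x\<in>W. (\<lambda>t. f (x(i := t))) field_differentiable at (x i)) \<and>
              Ck_on n W k (partial_deriv i f))"

definition smooth_on :: "nat \<Rightarrow> (nat \<Rightarrow> real) set \<Rightarrow> ((nat \<Rightarrow> real) \<Rightarrow> real) \<Rightarrow> bool"
  where "smooth_on n W f \<longleftrightarrow> (\<forall>k. Ck_on n W k f)"


section \<open>Smooth manifolds\<close>

(* The points of the manifold are all elements of the type 'm, whose sort makes it Hausdorff and
   second countable. A chart is a pair (U, \<phi>); only the values of \<phi> on U matter. *)

record 'm mfd =
  mdim :: nat
  atlas :: "('m set \<times> ('m \<Rightarrow> nat \<Rightarrow> real)) set"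

definition smooth_fun_on :: "'m::topological_space mfd \<Rightarrow> 'm set \<Rightarrow> ('m \<Rightarrow> real) \<Rightarrow> bool"
  where "smooth_fun_on M S f \<longleftrightarrow>
    (\<forall>(U, \<phi>) \<in> atlas M. smooth_on (mdim M) (\<phi> ` (U \<inter> S)) (\<lambda>x. f (inv_into U \<phi> x)))"

definition smooth_manifold :: "'m::{t2_space, second_countable_topology} mfd \<Rightarrow> bool"
  where "smooth_manifold M \<longleftrightarrow>
    (\<Union>(U, \<phi>) \<in> atlas M. U) = UNIV \<and>
    (\<forall>(U, \<phi>) \<in> atlas M. open U \<and> openin (Euclidean_space (mdim M)) (\<phi> ` U) \<and>
        homeomorphism U (\<phi> ` U) \<phi> (inv_into U \<phi>)) \<and>
    (\<forall>(U, \<phi>) \<in> atlas M. \<forall>(V, \<psi>) \<in> atlas M. \<forall>j<mdim M.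
        smooth_on (mdim M) (\<phi> ` (U \<inter> V)) (\<lambda>x. \<psi> (inv_into U \<phi> x) j))"

definition C_infinity :: "'m::topological_space mfd \<Rightarrow> ('m \<Rightarrow> real) set"
  where "C_infinity M = {f. smooth_fun_on M UNIV f}"


section \<open>Vector bundles\<close>

(* The fibres are subspaces of one ambient vector space 'v. This is no restriction: any
   family of vector spaces embeds in its direct sum. Fibres over different points may
   overlap; the total space is the disjoint union SIGMA p:UNIV. fibre A p. Its topology and
   smooth structure are given by the local trivialisations (U, \<Phi>), where \<Phi> p is a linear
   isomorphism from the fibre over p \<in> U onto R^k. *)

record ('m, 'v) vbundle =
  base :: "'m mfd"
  brank :: nat
  fibre :: "'m \<Rightarrow> 'v set"
  trivs :: "('m set \<times> ('m \<Rightarrow> 'v \<Rightarrow> nat \<Rightarrow> real)) set"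

(* frame A \<Phi> i p is the value at p of the i-th element of the local frame determined by \<Phi>. *)

definition frame :: "('m, 'v) vbundle \<Rightarrow> ('m \<Rightarrow> 'v \<Rightarrow> nat \<Rightarrow> real) \<Rightarrow> nat \<Rightarrow> 'm \<Rightarrow> 'v"
  where "frame A \<Phi> i p = inv_into (fibre A p) (\<Phi> p) (\<lambda>j. if j = i then 1 else 0)"

definition vector_bundle ::
    "('m::{t2_space, second_countable_topology}, 'v::real_vector) vbundle \<Rightarrow> bool"
  where "vector_bundle A \<longleftrightarrow>
    smooth_manifold (base A) \<and>
    (\<forall>p. subspace (fibre A p)) \<and>
    (\<Union>(U, \<Phi>) \<in> trivs A. U) = UNIV \<and>
    (\<forall>(U, \<Phi>) \<in> trivs A. open U \<and>
        (\<forall>p\<in>U. linear_on (fibre A p) (\<Phi> p) \<and>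
                bij_betw (\<Phi> p) (fibre A p) (topspace (Euclidean_space (brank A))))) \<and>
    (\<forall>(U, \<Phi>) \<in> trivs A. \<forall>(V, \<Psi>) \<in> trivs A. \<forall>i<brank A. \<forall>j<brank A.
        smooth_fun_on (base A) (U \<inter> V) (\<lambda>p. \<Psi> p (frame A \<Phi> i p) j))"

definition sections :: "('m::topological_space, 'v) vbundle \<Rightarrow> ('m \<Rightarrow> 'v) set"
  where "sections A =
    {X. (\<forall>p. X p \<in> fibre A p) \<and>
        (\<forall>(U, \<Phi>) \<in> trivs A. \<forall>j<brank A. smooth_fun_on (base A) U (\<lambda>p. \<Phi> p (X p) j))}"

(* Smooth homomorphisms over the identity; smoothness says that the matrix of h with respect
   to local trivialisations has smooth entries. *)

definition bundle_hom :: "('m::topological_space, 'v::real_vector) vbundle \<Rightarrow>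
    ('m, 'w::real_vector) vbundle \<Rightarrow> ('m \<Rightarrow> 'v \<Rightarrow> 'w) \<Rightarrow> bool"
  where "bundle_hom A B h \<longleftrightarrow>
    base A = base B \<and>
    (\<forall>p. linear_on (fibre A p) (h p) \<and> h p ` fibre A p \<subseteq> fibre B p) \<and>
    (\<forall>(U, \<Phi>) \<in> trivs A. \<forall>(V, \<Psi>) \<in> trivs B. \<forall>i<brank A. \<forall>j<brank B.
        smooth_fun_on (base A) (U \<inter> V) (\<lambda>p. \<Psi> p (h p (frame A \<Phi> i p)) j))"


section \<open>The tangent bundle\<close>

definition smooth_near :: "'m::topological_space mfd \<Rightarrow> 'm \<Rightarrow> ('m \<Rightarrow> real) \<Rightarrow> bool"
  where "smooth_near M p f \<longleftrightarrow> (\<exists>S. open S \<and> p \<in> S \<and> smooth_fun_on M S f)"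

(* Derivations at p of the algebra of functions that are smooth near p. The value v f depends
   only on the germ of f at p: if f = 0 near p, let h be 0 near p and 1 elsewhere; then f = f * h
   and the Leibniz rule gives v f = 0. The value 0 on the other functions makes equality of
   tangent vectors an equality of functions. *)

definition tangent_space :: "'m::topological_space mfd \<Rightarrow> 'm \<Rightarrow> (('m \<Rightarrow> real) \<Rightarrow> real) set"
  where "tangent_space M p =
    {v. linear_on {f. smooth_near M p f} v \<and>
        (\<forall>f g. smooth_near M p f \<longrightarrow> smooth_near M p g \<longrightarrow> v (f * g) = f p * v g + g p * v f) \<and>
        (\<forall>f. \<not> smooth_near M p f \<longrightarrow> v f = 0)}"

(* A chart \<phi> trivialises the tangent bundle by the components v(\<phi>_0), ..., v(\<phi>_(n-1)). *)

definition tangent_bundle ::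
    "'m::topological_space mfd \<Rightarrow> ('m, ('m \<Rightarrow> real) \<Rightarrow> real) vbundle"
  where "tangent_bundle M =
    \<lparr>base = M, brank = mdim M, fibre = tangent_space M,
     trivs = (\<lambda>(U, \<phi>). (U, \<lambda>p v j. if j < mdim M then v (\<lambda>q. \<phi> q j) else 0)) ` atlas M\<rparr>"


section \<open>Tensor fields\<close>

definition pseudo_riemannian_metric ::
    "('m::topological_space, 'v::real_vector) vbundle \<Rightarrow> ('m \<Rightarrow> 'v \<Rightarrow> 'v \<Rightarrow> real) \<Rightarrow> bool"
  where "pseudo_riemannian_metric A g \<longleftrightarrow>
    (\<forall>p. \<forall>a\<in>fibre A p. linear_on (fibre A p) (g p a)) \<and>
    (\<forall>p. \<forall>a\<in>fibre A p. \<forall>b\<in>fibre A p. g p a b = g p b a) \<and>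
    (\<forall>p. \<forall>a\<in>fibre A p. (\<forall>b\<in>fibre A p. g p a b = 0) \<longrightarrow> a = 0) \<and>
    (\<forall>(U, \<Phi>) \<in> trivs A. \<forall>i<brank A. \<forall>j<brank A.
        smooth_fun_on (base A) U (\<lambda>p. g p (frame A \<Phi> i p) (frame A \<Phi> j p)))"

(* Sections of \<Lambda>^3 A^*. *)

definition three_form ::
    "('m::topological_space, 'v::real_vector) vbundle \<Rightarrow> ('m \<Rightarrow> 'v \<Rightarrow> 'v \<Rightarrow> 'v \<Rightarrow> real) \<Rightarrow> bool"
  where "three_form A \<omega> \<longleftrightarrow>
    (\<forall>p. \<forall>a\<in>fibre A p. \<forall>b\<in>fibre A p. linear_on (fibre A p) (\<omega> p a b)) \<and>
    (\<forall>p. \<forall>a\<in>fibre A p. \<forall>b\<in>fibre A p. \<forall>c\<in>fibre A p.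
        \<omega> p b a c = - \<omega> p a b c \<and> \<omega> p a c b = - \<omega> p a b c) \<and>
    (\<forall>(U, \<Phi>) \<in> trivs A. \<forall>i<brank A. \<forall>j<brank A. \<forall>l<brank A.
        smooth_fun_on (base A) U (\<lambda>p. \<omega> p (frame A \<Phi> i p) (frame A \<Phi> j p) (frame A \<Phi> l p)))"

(* Sections of \<Lambda>^2 A^* \<otimes> A. *)

definition bundle_valued_two_form ::
    "('m::topological_space, 'v::real_vector) vbundle \<Rightarrow> ('m \<Rightarrow> 'v \<Rightarrow> 'v \<Rightarrow> 'v) \<Rightarrow> bool"
  where "bundle_valued_two_form A T \<longleftrightarrow>
    (\<forall>p. \<forall>a\<in>fibre A p. linear_on (fibre A p) (T p a) \<and> T p a ` fibre A p \<subseteq> fibre A p) \<and>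
    (\<forall>p. \<forall>a\<in>fibre A p. \<forall>b\<in>fibre A p. T p b a = - T p a b) \<and>
    (\<forall>(U, \<Phi>) \<in> trivs A. \<forall>i<brank A. \<forall>j<brank A. \<forall>l<brank A.
        smooth_fun_on (base A) U (\<lambda>p. \<Phi> p (T p (frame A \<Phi> i p) (frame A \<Phi> j p)) l))"


section \<open>Brackets and connections\<close>

type_synonym ('m, 'v) operation = "('m \<Rightarrow> 'v) \<Rightarrow> ('m \<Rightarrow> 'v) \<Rightarrow> 'm \<Rightarrow> 'v"

definition anchored_bundle ::
    "('m::{t2_space, second_countable_topology}, 'v::real_vector) vbundle \<Rightarrow>
      ('m \<Rightarrow> 'v \<Rightarrow> ('m \<Rightarrow> real) \<Rightarrow> real) \<Rightarrow> bool"
  where "anchored_bundle A \<rho> \<longleftrightarrow>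
    vector_bundle A \<and> bundle_hom A (tangent_bundle (base A)) \<rho>"

(* The function (\<rho> o X)(f). *)

definition anchor_deriv ::
    "('m \<Rightarrow> 'v \<Rightarrow> ('m \<Rightarrow> real) \<Rightarrow> real) \<Rightarrow> ('m \<Rightarrow> 'v) \<Rightarrow> ('m \<Rightarrow> real) \<Rightarrow> 'm \<Rightarrow> real"
  where "anchor_deriv \<rho> X f = (\<lambda>p. \<rho> p (X p) f)"

definition fmul :: "('m \<Rightarrow> real) \<Rightarrow> ('m \<Rightarrow> 'v::real_vector) \<Rightarrow> 'm \<Rightarrow> 'v"  (infixr \<open>\<cdot>\<close> 75)
  where "f \<cdot> X = (\<lambda>p. f p *\<^sub>R X p)"

definition bilinear_on_sections ::
    "('m::topological_space, 'v::real_vector) vbundle \<Rightarrow> ('m, 'v) operation \<Rightarrow> bool"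
  where "bilinear_on_sections A B \<longleftrightarrow>
    (\<forall>X\<in>sections A. \<forall>Y\<in>sections A. B X Y \<in> sections A) \<and>
    (\<forall>X\<in>sections A. linear_on (sections A) (B X)) \<and>
    (\<forall>Y\<in>sections A. linear_on (sections A) (\<lambda>X. B X Y))"

definition leibniz_rule :: "('m::topological_space, 'v::real_vector) vbundle \<Rightarrow>
    ('m \<Rightarrow> 'v \<Rightarrow> ('m \<Rightarrow> real) \<Rightarrow> real) \<Rightarrow> ('m, 'v) operation \<Rightarrow> bool"
  where "leibniz_rule A \<rho> B \<longleftrightarrow>
    (\<forall>X\<in>sections A. \<forall>Y\<in>sections A. \<forall>f\<in>C_infinity (base A).
        B X (f \<cdot> Y) = f \<cdot> B X Y + anchor_deriv \<rho> X f \<cdot> Y)"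

definition skew_symmetric_algebroid ::
    "('m::{t2_space, second_countable_topology}, 'v::real_vector) vbundle \<Rightarrow>
      ('m \<Rightarrow> 'v \<Rightarrow> ('m \<Rightarrow> real) \<Rightarrow> real) \<Rightarrow> ('m, 'v) operation \<Rightarrow> bool"
  where "skew_symmetric_algebroid A \<rho> br \<longleftrightarrow>
    anchored_bundle A \<rho> \<and> bilinear_on_sections A br \<and>
    (\<forall>X\<in>sections A. \<forall>Y\<in>sections A. br Y X = - br X Y) \<and> leibniz_rule A \<rho> br"

definition symmetric_bracket :: "('m::topological_space, 'v::real_vector) vbundle \<Rightarrow>
    ('m \<Rightarrow> 'v \<Rightarrow> ('m \<Rightarrow> real) \<Rightarrow> real) \<Rightarrow> ('m, 'v) operation \<Rightarrow> bool"
  where "symmetric_bracket A \<rho> sb \<longleftrightarrow>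
    bilinear_on_sections A sb \<and>
    (\<forall>X\<in>sections A. \<forall>Y\<in>sections A. sb Y X = sb X Y) \<and> leibniz_rule A \<rho> sb"

definition A_connection :: "('m::topological_space, 'v::real_vector) vbundle \<Rightarrow>
    ('m \<Rightarrow> 'v \<Rightarrow> ('m \<Rightarrow> real) \<Rightarrow> real) \<Rightarrow> ('m, 'v) operation \<Rightarrow> bool"
  where "A_connection A \<rho> D \<longleftrightarrow>
    bilinear_on_sections A D \<and>
    (\<forall>X\<in>sections A. \<forall>Y\<in>sections A. \<forall>f\<in>C_infinity (base A). D (f \<cdot> X) Y = f \<cdot> D X Y) \<and>
    leibniz_rule A \<rho> D"

definition torsion :: "('m, 'v::real_vector) operation \<Rightarrow> ('m, 'v) operation \<Rightarrow> ('m, 'v) operation"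
  where "torsion br D X Y = D X Y - D Y X - br X Y"

definition totally_skew_symmetric :: "('m::topological_space, 'v::real_vector) vbundle \<Rightarrow>
    ('m \<Rightarrow> 'v \<Rightarrow> 'v \<Rightarrow> real) \<Rightarrow> ('m, 'v) operation \<Rightarrow> bool"
  where "totally_skew_symmetric A g \<tau> \<longleftrightarrow>
    (\<exists>\<omega>. three_form A \<omega> \<and>
      (\<forall>X\<in>sections A. \<forall>Y\<in>sections A. \<forall>Z\<in>sections A. \<forall>p.
          g p (\<tau> X Y p) (Z p) = \<omega> p (X p) (Y p) (Z p)))"

definition alt_lie_deriv :: "('m \<Rightarrow> 'v \<Rightarrow> ('m \<Rightarrow> real) \<Rightarrow> real) \<Rightarrow> ('m, 'v) operation \<Rightarrow>
    ('m \<Rightarrow> 'v) \<Rightarrow> ('m \<Rightarrow> 'v \<Rightarrow> 'v \<Rightarrow> real) \<Rightarrow> ('m \<Rightarrow> 'v) \<Rightarrow> ('m \<Rightarrow> 'v) \<Rightarrow> 'm \<Rightarrow> real"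
  where "alt_lie_deriv \<rho> br X g Y Z =
    (\<lambda>p. anchor_deriv \<rho> X (\<lambda>q. g q (Y q) (Z q)) p - g p (br X Y p) (Z p) - g p (Y p) (br X Z p))"

definition sym_lie_deriv :: "('m \<Rightarrow> 'v \<Rightarrow> ('m \<Rightarrow> real) \<Rightarrow> real) \<Rightarrow> ('m, 'v) operation \<Rightarrow>
    ('m \<Rightarrow> 'v) \<Rightarrow> ('m \<Rightarrow> 'v \<Rightarrow> 'v \<Rightarrow> real) \<Rightarrow> ('m \<Rightarrow> 'v) \<Rightarrow> ('m \<Rightarrow> 'v) \<Rightarrow> 'm \<Rightarrow> real"
  where "sym_lie_deriv \<rho> sb X g Y Z =
    (\<lambda>p. anchor_deriv \<rho> X (\<lambda>q. g q (Y q) (Z q)) p - g p (sb X Y p) (Z p) - g p (Y p) (sb X Z p))"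

definition cov_deriv_metric :: "('m \<Rightarrow> 'v \<Rightarrow> ('m \<Rightarrow> real) \<Rightarrow> real) \<Rightarrow> ('m, 'v) operation \<Rightarrow>
    ('m \<Rightarrow> 'v \<Rightarrow> 'v \<Rightarrow> real) \<Rightarrow> ('m \<Rightarrow> 'v) \<Rightarrow> ('m \<Rightarrow> 'v) \<Rightarrow> ('m \<Rightarrow> 'v) \<Rightarrow> 'm \<Rightarrow> real"
  where "cov_deriv_metric \<rho> D g X Y Z =
    (\<lambda>p. anchor_deriv \<rho> X (\<lambda>q. g q (Y q) (Z q)) p - g p (D X Y p) (Z p) - g p (Y p) (D X Z p))"

definition metric_connection :: "('m::topological_space, 'v) vbundle \<Rightarrow>
    ('m \<Rightarrow> 'v \<Rightarrow> ('m \<Rightarrow> real) \<Rightarrow> real) \<Rightarrow> ('m \<Rightarrow> 'v \<Rightarrow> 'v \<Rightarrow> real) \<Rightarrow> ('m, 'v) operation \<Rightarrow> bool"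
  where "metric_connection A \<rho> g D \<longleftrightarrow>
    (\<forall>X\<in>sections A. \<forall>Y\<in>sections A. \<forall>Z\<in>sections A. cov_deriv_metric \<rho> D g X Y Z = 0)"


section \<open>The connection given by two brackets and a torsion tensor\<close>

lemma eventually_upd_mem:
  assumes W: "openin (Euclidean_space n) W" and x: "x \<in> W" and i: "i < n"
  shows "\<forall>\<^sub>F t in nhds (x i). x(i := t) \<in> W"
proof -
  obtain O' where O': "open O'" "W = O' \<inter> {x. \<forall>i\<ge>n. x i = 0}"
    using W unfolding Euclidean_space_def openin_subtopology
    by (auto simp: euclidean_product_topology)
  have "continuous_on UNIV (\<lambda>t. if j = i then t else x j)" for j
    by (cases "j = i") auto
  then have "continuous_on UNIV (\<lambda>t. x(i := t))"
    by (intro continuous_on_coordinatewise_then_product) (simp add: fun_upd_def)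
  then have "open ((\<lambda>t. x(i := t)) -` O')"
    using O'(1) by (simp add: open_vimage)
  moreover have "x i \<in> (\<lambda>t. x(i := t)) -` O'" using x O'(2) by simp
  ultimately have "\<forall>\<^sub>F t in nhds (x i). x(i := t) \<in> O'"
    by (auto simp: eventually_nhds)
  then show ?thesis
    by eventually_elim (use x i O'(2) in auto)
qed

lemma Ck_on_cong:
  assumes W: "openin (Euclidean_space n) W" and "\<And>x. x \<in> W \<Longrightarrow> f x = h x" and "Ck_on n W k f"
  shows "Ck_on n W k h"
  using assms(2,3)
proof (induction k arbitrary: f h)
  case 0
  then show ?case by (auto cong: continuous_on_cong_simp)
next
  case (Suc k)
  have c: "continuous_on W h"
    using Suc.prems by (auto cong: continuous_on_cong_simp)
  have ev: "\<forall>\<^sub>F t in nhds (x i). f (x(i := t)) = h (x(i := t))" if "x \<in> W" "i < n" for x i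
    using eventually_upd_mem[OF W that] by eventually_elim (use Suc.prems in auto)
  have fd: "(\<lambda>t. h (x(i := t))) field_differentiable at (x i)" if "x \<in> W" "i < n" for x i
  proof -
    have "(\<lambda>t. f (x(i := t))) field_differentiable at (x i)"
      using Suc.prems(2) that by auto
    then obtain d where "((\<lambda>t. f (x(i := t))) has_field_derivative d) (at (x i))"
      unfolding field_differentiable_def by blast
    then have "((\<lambda>t. h (x(i := t))) has_field_derivative d) (at (x i))"
      using DERIV_cong_ev[OF refl ev[OF that] refl] by blast
    then show ?thesis by (auto simp: field_differentiable_def)
  qed
  have "partial_deriv i f x = partial_deriv i h x" if "x \<in> W" "i < n" for x i
    unfolding partial_deriv_def by (rule deriv_cong_ev[OF ev[OF that] refl])
  then have "Ck_on n W k (partial_deriv i h)" if "i < n" for i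
    using Suc.IH[of "partial_deriv i f" "partial_deriv i h"] Suc.prems(2) that by simp
  then show ?case using c fd by auto
qed

lemma Ck_on_Suc: "Ck_on n W (Suc k) f \<Longrightarrow> Ck_on n W k f"
  by (induction k arbitrary: f) auto

lemma Ck_on_const: "Ck_on n W k (\<lambda>x. c)"
proof (induction k arbitrary: c)
  case (Suc k)
  have "partial_deriv i (\<lambda>x. c) = (\<lambda>x. 0)" for i by (auto simp: partial_deriv_def)
  then show ?case using Suc by auto
qed auto

lemma Ck_on_add:
  assumes W: "openin (Euclidean_space n) W" and "Ck_on n W k f" "Ck_on n W k h"
  shows "Ck_on n W k (\<lambda>x. f x + h x)"
  using assms(2,3)
proof (induction k arbitrary: f h)
  case (Suc k)
  have "Ck_on n W k (partial_deriv i (\<lambda>x. f x + h x))" if "i < n" for i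
    by (rule Ck_on_cong[OF W _ Suc.IH[of "partial_deriv i f" "partial_deriv i h"]])
       (use Suc.prems that in \<open>simp_all add: partial_deriv_def[abs_def]\<close>)
  then show ?case using Suc.prems by (simp add: continuous_on_add field_differentiable_add)
qed (simp add: continuous_on_add)

lemma Ck_on_mult:
  assumes W: "openin (Euclidean_space n) W" and "Ck_on n W k f" "Ck_on n W k h"
  shows "Ck_on n W k (\<lambda>x. f x * h x)"
  using assms(2,3)
proof (induction k arbitrary: f h)
  case (Suc k)
  have "Ck_on n W k (partial_deriv i (\<lambda>x. f x * h x))" if "i < n" for i
    by (rule Ck_on_cong[OF W _ Ck_on_add[OF W Suc.IH[of f "partial_deriv i h"] Suc.IH[of "partial_deriv i f" h]]])
       (use Suc.prems that Ck_on_Suc[OF Suc.prems(1)] Ck_on_Suc[OF Suc.prems(2)]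
         in \<open>simp_all add: partial_deriv_def[abs_def]\<close>)
  then show ?case using Suc.prems by (simp add: continuous_on_mult field_differentiable_mult)
qed (simp add: continuous_on_mult)

lemma chart_image_open:
  assumes M: "smooth_manifold M" and S: "open S" and c: "(U, \<phi>) \<in> atlas M"
  shows "openin (Euclidean_space (mdim M)) (\<phi> ` (U \<inter> S))"
proof -
  have op: "openin (Euclidean_space (mdim M)) (\<phi> ` U)"
    and h: "homeomorphism U (\<phi> ` U) \<phi> (inv_into U \<phi>)"
    using M c by (auto simp: smooth_manifold_def)
  have "openin (top_of_set U) (U \<inter> S)" using S by (simp add: openin_open_Int)
  then have "openin (top_of_set (\<phi> ` U)) (\<phi> ` (U \<inter> S))"
    using homeomorphism_imp_open_map[OF h] by blast
  then obtain O' where "open O'" "\<phi> ` (U \<inter> S) = \<phi> ` U \<inter> O'" by (auto simp: openin_open)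
  moreover have "openin (Euclidean_space (mdim M)) (\<phi> ` U \<inter> O')"
  proof -
    have "openin (Euclidean_space (mdim M)) (O' \<inter> {x. \<forall>i\<ge>mdim M. x i = 0})"
      unfolding Euclidean_space_def openin_subtopology
      using \<open>open O'\<close> by (auto simp: euclidean_product_topology)
    moreover have "\<phi> ` U \<inter> O' = \<phi> ` U \<inter> (O' \<inter> {x. \<forall>i\<ge>mdim M. x i = 0})"
      using openin_subset[OF op] by (auto simp: topspace_Euclidean_space)
    ultimately show ?thesis using openin_Int[OF op] by simp
  qed
  ultimately show ?thesis by simp
qed

lemma smooth_fun_on_const: "smooth_fun_on M S (\<lambda>p. c)"
  by (auto simp: smooth_fun_on_def smooth_on_def Ck_on_const)

lemma smooth_fun_on_add:
  assumes M: "smooth_manifold M" "open S" and "smooth_fun_on M S f" "smooth_fun_on M S h"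
  shows "smooth_fun_on M S (\<lambda>p. f p + h p)"
  unfolding smooth_fun_on_def smooth_on_def
proof (clarify)
  fix U \<phi> k assume c: "(U, \<phi>) \<in> atlas M"
  show "Ck_on (mdim M) (\<phi> ` (U \<inter> S)) k (\<lambda>x. f (inv_into U \<phi> x) + h (inv_into U \<phi> x))"
    by (rule Ck_on_add[OF chart_image_open[OF M c]])
       (use assms(3,4) c in \<open>unfold smooth_fun_on_def smooth_on_def, blast+\<close>)
qed

lemma smooth_fun_on_mult:
  assumes M: "smooth_manifold M" "open S" and "smooth_fun_on M S f" "smooth_fun_on M S h"
  shows "smooth_fun_on M S (\<lambda>p. f p * h p)"
  unfolding smooth_fun_on_def smooth_on_def
proof (clarify)
  fix U \<phi> k assume c: "(U, \<phi>) \<in> atlas M"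
  show "Ck_on (mdim M) (\<phi> ` (U \<inter> S)) k (\<lambda>x. f (inv_into U \<phi> x) * h (inv_into U \<phi> x))"
    by (rule Ck_on_mult[OF chart_image_open[OF M c]])
       (use assms(3,4) c in \<open>unfold smooth_fun_on_def smooth_on_def, blast+\<close>)
qed

lemma smooth_fun_on_sum:
  assumes M: "smooth_manifold M" "open S" and "finite I" "\<And>i. i \<in> I \<Longrightarrow> smooth_fun_on M S (f i)"
  shows "smooth_fun_on M S (\<lambda>p. \<Sum>i\<in>I. f i p)"
  using assms(3,4)
  by (induction I) (simp_all add: smooth_fun_on_const smooth_fun_on_add[OF M])

lemma smooth_fun_on_cong:
  assumes M: "smooth_manifold M" "open S" and "\<And>p. p \<in> S \<Longrightarrow> f p = h p" "smooth_fun_on M S f"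
  shows "smooth_fun_on M S h"
  unfolding smooth_fun_on_def
proof (clarify)
  fix U \<phi> assume c: "(U, \<phi>) \<in> atlas M"
  have "homeomorphism U (\<phi> ` U) \<phi> (inv_into U \<phi>)"
    using M c by (auto simp: smooth_manifold_def)
  then have inj: "inj_on \<phi> U"
    by (metis homeomorphism_def inj_on_inverseI)
  have "f (inv_into U \<phi> x) = h (inv_into U \<phi> x)" if "x \<in> \<phi> ` (U \<inter> S)" for x
    using that assms(3) inj by auto
  moreover have "Ck_on (mdim M) (\<phi> ` (U \<inter> S)) k (\<lambda>x. f (inv_into U \<phi> x))" for k
    using assms(4) c by (auto simp: smooth_fun_on_def smooth_on_def)
  ultimately have "Ck_on (mdim M) (\<phi> ` (U \<inter> S)) k (\<lambda>x. h (inv_into U \<phi> x))" for k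
    by (rule Ck_on_cong[OF chart_image_open[OF M c]])
  then show "smooth_on (mdim M) (\<phi> ` (U \<inter> S)) (\<lambda>x. h (inv_into U \<phi> x))"
    by (simp add: smooth_on_def)
qed

lemma smooth_fun_on_mono:
  assumes M: "smooth_manifold M" and S: "open S" "S' \<subseteq> S" "open S'" and f: "smooth_fun_on M S f"
  shows "smooth_fun_on M S' f"
proof -
  have r: "Ck_on n W' k f" if "W' \<subseteq> W" "Ck_on n W k f" for n W W' k f
    using that(2) by (induction k arbitrary: f) (use that(1) in \<open>auto intro: continuous_on_subset\<close>)
  show ?thesis
    unfolding smooth_fun_on_def smooth_on_def
  proof (clarify)
    fix U \<phi> k assume c: "(U, \<phi>) \<in> atlas M"
    have "\<phi> ` (U \<inter> S') \<subseteq> \<phi> ` (U \<inter> S)" using S by blast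
    moreover have "Ck_on (mdim M) (\<phi> ` (U \<inter> S)) k (\<lambda>x. f (inv_into U \<phi> x))"
      using f c by (auto simp: smooth_fun_on_def smooth_on_def)
    ultimately show "Ck_on (mdim M) (\<phi> ` (U \<inter> S')) k (\<lambda>x. f (inv_into U \<phi> x))" by (rule r)
  qed
qed

lemma sections_add:
  assumes A: "vector_bundle A" and X: "X \<in> sections A" and Y: "Y \<in> sections A"
  shows "X + Y \<in> sections A"
  unfolding sections_def
proof (clarify, intro conjI allI ballI, goal_cases)
  case (1 p) show ?case using A X Y by (auto simp: vector_bundle_def sections_def intro: subspace_add)
next
  case (2 c)
  obtain U \<Phi> where c: "c = (U, \<Phi>)" by force
  have M: "smooth_manifold (base A)" "open U" using A 2 c by (auto simp: vector_bundle_def)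
  have l: "\<Phi> p (X p) j + \<Phi> p (Y p) j = \<Phi> p ((X + Y) p) j" if "p \<in> U" for p j
  proof -
    have "linear_on (fibre A p) (\<Phi> p)" using A 2 c that by (auto simp: vector_bundle_def)
    then show ?thesis using X Y by (auto simp: linear_on_def sections_def)
  qed
  show ?case unfolding c
    apply clarify
    apply (rule smooth_fun_on_cong[OF M l smooth_fun_on_add[OF M]])
    using X Y 2 c by (auto simp: sections_def)
qed

lemma sections_fmul:
  assumes A: "vector_bundle A" and X: "X \<in> sections A" and f: "f \<in> C_infinity (base A)"
  shows "f \<cdot> X \<in> sections A"
  unfolding sections_def
proof (clarify, intro conjI allI ballI, goal_cases)
  case (1 p) show ?case using A X by (auto simp: vector_bundle_def sections_def fmul_def intro: subspace_scale)
next
  case (2 c)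
  obtain U \<Phi> where c: "c = (U, \<Phi>)" by force
  have M: "smooth_manifold (base A)" "open U" using A 2 c by (auto simp: vector_bundle_def)
  have l: "f p * \<Phi> p (X p) j = \<Phi> p ((f \<cdot> X) p) j" if "p \<in> U" for p j
  proof -
    have "linear_on (fibre A p) (\<Phi> p)" using A 2 c that by (auto simp: vector_bundle_def)
    then show ?thesis using X by (auto simp: linear_on_def sections_def fmul_def scaleR_fun_def)
  qed
  have fs: "smooth_fun_on (base A) U f"
    using f smooth_fun_on_mono[OF M(1) open_UNIV subset_UNIV M(2)] by (simp add: C_infinity_def)
  show ?case unfolding c
    apply clarify
    apply (rule smooth_fun_on_cong[OF M l smooth_fun_on_mult[OF M fs]])
    using X 2 c by (auto simp: sections_def)
qed

lemma sections_scale: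
  assumes A: "vector_bundle A" and X: "X \<in> sections A"
  shows "c *\<^sub>R X \<in> sections A"
  using sections_fmul[OF A X, of "\<lambda>p. c"]
  by (simp add: C_infinity_def smooth_fun_on_const fmul_def scaleR_fun_def)

lemma linear_on_sum:
  assumes f: "linear_on V f" and V: "subspace V" and "finite I" "\<And>i. i \<in> I \<Longrightarrow> e i \<in> V"
  shows "f (\<Sum>i\<in>I. c i *\<^sub>R e i) = (\<Sum>i\<in>I. c i *\<^sub>R f (e i))"
  using assms(3,4)
proof (induction I)
  case empty
  have "f (0 *\<^sub>R 0) = 0 *\<^sub>R f 0" using f subspace_0[OF V] unfolding linear_on_def by blast
  then show ?case by simp
next
  case (insert i I)
  have "(\<Sum>i\<in>I. c i *\<^sub>R e i) \<in> V" using insert V by (auto intro: subspace_sum subspace_scale)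
  moreover have "c i *\<^sub>R e i \<in> V" using insert V by (auto intro: subspace_scale)
  ultimately show ?case using insert f by (simp add: linear_on_def)
qed

lemma sum_fun_app: "(\<Sum>i\<in>I. (F i :: 'a \<Rightarrow> 'b::comm_monoid_add)) x = (\<Sum>i\<in>I. F i x)"
  by (induction I rule: infinite_finite_induct) auto

lemma frame_props:
  assumes A: "vector_bundle A" and c: "(U, \<Phi>) \<in> trivs A" and p: "p \<in> U" and i: "i < brank A"
  shows "frame A \<Phi> i p \<in> fibre A p" "\<Phi> p (frame A \<Phi> i p) = (\<lambda>j. if j = i then 1 else 0)"
proof -
  have "bij_betw (\<Phi> p) (fibre A p) (topspace (Euclidean_space (brank A)))"
    using A c p by (auto simp: vector_bundle_def)
  moreover have "(\<lambda>j. if j = i then 1 else 0) \<in> topspace (Euclidean_space (brank A))"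
    using i by (auto simp: topspace_Euclidean_space)
  ultimately have m: "(\<lambda>j. if j = i then 1 else 0) \<in> \<Phi> p ` fibre A p" by (simp add: bij_betw_def)
  show "frame A \<Phi> i p \<in> fibre A p" "\<Phi> p (frame A \<Phi> i p) = (\<lambda>j. if j = i then 1 else 0)"
    unfolding frame_def by (rule inv_into_into[OF m], rule f_inv_into_f[OF m])
qed

lemma frame_expand:
  assumes A: "vector_bundle A" and c: "(U, \<Phi>) \<in> trivs A" and p: "p \<in> U" and a: "a \<in> fibre A p"
  shows "a = (\<Sum>i<brank A. \<Phi> p a i *\<^sub>R frame A \<Phi> i p)"
proof -
  have b: "bij_betw (\<Phi> p) (fibre A p) (topspace (Euclidean_space (brank A)))"
    and l: "linear_on (fibre A p) (\<Phi> p)" and V: "subspace (fibre A p)"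
    using A c p by (auto simp: vector_bundle_def)
  note fr = frame_props[OF A c p]
  have "\<Phi> p (\<Sum>i<brank A. \<Phi> p a i *\<^sub>R frame A \<Phi> i p) = (\<Sum>i<brank A. \<Phi> p a i *\<^sub>R \<Phi> p (frame A \<Phi> i p))"
    using fr by (intro linear_on_sum[OF l V]) auto
  also have "\<dots> = \<Phi> p a"
  proof
    fix j
    have "\<Phi> p a \<in> topspace (Euclidean_space (brank A))" using b a by (auto simp: bij_betw_def)
    then have z: "j \<ge> brank A \<Longrightarrow> \<Phi> p a j = 0" by (simp add: topspace_Euclidean_space)
    have "(\<Sum>i<brank A. \<Phi> p a i *\<^sub>R \<Phi> p (frame A \<Phi> i p)) j = (\<Sum>i<brank A. if j = i then \<Phi> p a i else 0)"
      unfolding sum_fun_app by (intro sum.cong) (auto simp: fr scaleR_fun_def)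
    then show "(\<Sum>i<brank A. \<Phi> p a i *\<^sub>R \<Phi> p (frame A \<Phi> i p)) j = \<Phi> p a j" using z by auto
  qed
  finally have "\<Phi> p (\<Sum>i<brank A. \<Phi> p a i *\<^sub>R frame A \<Phi> i p) = \<Phi> p a" .
  moreover have "(\<Sum>i<brank A. \<Phi> p a i *\<^sub>R frame A \<Phi> i p) \<in> fibre A p"
    using fr V by (auto intro!: subspace_sum subspace_scale)
  ultimately show ?thesis using b a by (metis bij_betw_def inj_onD)
qed

lemma two_form_sections:
  assumes A: "vector_bundle A" and T: "bundle_valued_two_form A T"
    and X: "X \<in> sections A" and Y: "Y \<in> sections A"
  shows "(\<lambda>p. T p (X p) (Y p)) \<in> sections A"
proof -
  have M: "smooth_manifold (base A)" using A by (simp add: vector_bundle_def)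
  have mem: "T p a b \<in> fibre A p" if "a \<in> fibre A p" "b \<in> fibre A p" for p a b
    using T that unfolding bundle_valued_two_form_def by blast
  have XY: "X p \<in> fibre A p" "Y p \<in> fibre A p" for p using X Y by (auto simp: sections_def)
  have "smooth_fun_on (base A) U (\<lambda>p. \<Phi> p (T p (X p) (Y p)) l)"
    if c: "(U, \<Phi>) \<in> trivs A" and l: "l < brank A" for U \<Phi> l
  proof -
    have U: "open U" using A c by (auto simp: vector_bundle_def)
    have eq: "(\<Sum>i<brank A. \<Sum>j<brank A. \<Phi> p (X p) i * (\<Phi> p (Y p) j * \<Phi> p (T p (frame A \<Phi> i p) (frame A \<Phi> j p)) l)) = \<Phi> p (T p (X p) (Y p)) l"
      if p: "p \<in> U" for p
    proof -
      have V: "subspace (fibre A p)" and lP: "linear_on (fibre A p) (\<Phi> p)"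
        using A c p by (auto simp: vector_bundle_def)
      note fr = frame_props(1)[OF A c p]
      have sk: "T p b a = - T p a b" if "a \<in> fibre A p" "b \<in> fibre A p" for a b
        using T that unfolding bundle_valued_two_form_def by blast
      have lT: "linear_on (fibre A p) (T p a)" if "a \<in> fibre A p" for a
        using T that by (auto simp: bundle_valued_two_form_def)
      have l2: "linear_on (fibre A p) (\<lambda>b. \<Phi> p (T p a b) l)" if "a \<in> fibre A p" for a
        using lP lT[OF that] mem[OF that] by (auto simp: linear_on_def scaleR_fun_def)
      have l1: "linear_on (fibre A p) (\<lambda>a. \<Phi> p (T p a b) l)" if b: "b \<in> fibre A p" for b
      proof -
        have "T p (a + a') b = T p a b + T p a' b" if "a \<in> fibre A p" "a' \<in> fibre A p" for a a'
          using sk[OF b subspace_add[OF V that]] sk[OF b that(1)] sk[OF b that(2)] lT[OF b] that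
          by (simp add: linear_on_def)
        moreover have "T p (r *\<^sub>R a) b = r *\<^sub>R T p a b" if "a \<in> fibre A p" for a r
          using sk[OF b subspace_scale[OF V that]] sk[OF b that] lT[OF b] that
          by (simp add: linear_on_def)
        ultimately show ?thesis using lP mem[OF _ b] by (auto simp: linear_on_def scaleR_fun_def)
      qed
      have "\<Phi> p (T p (X p) (Y p)) l = \<Phi> p (T p (\<Sum>i<brank A. \<Phi> p (X p) i *\<^sub>R frame A \<Phi> i p) (Y p)) l"
        by (rule arg_cong[where f = "\<lambda>a. \<Phi> p (T p a (Y p)) l", OF frame_expand[OF A c p XY(1)]])
      also have "\<dots> = (\<Sum>i<brank A. \<Phi> p (X p) i * \<Phi> p (T p (frame A \<Phi> i p) (Y p)) l)"
        by (subst linear_on_sum[OF l1[OF XY(2)] V]) (auto intro: fr)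
      also have "\<dots> = (\<Sum>i<brank A. \<Phi> p (X p) i * (\<Sum>j<brank A. \<Phi> p (Y p) j * \<Phi> p (T p (frame A \<Phi> i p) (frame A \<Phi> j p)) l))"
      proof (intro sum.cong refl)
        fix i assume i: "i \<in> {..<brank A}"
        have "\<Phi> p (T p (frame A \<Phi> i p) (Y p)) l = \<Phi> p (T p (frame A \<Phi> i p) (\<Sum>j<brank A. \<Phi> p (Y p) j *\<^sub>R frame A \<Phi> j p)) l"
          by (rule arg_cong[where f = "\<lambda>a. \<Phi> p (T p (frame A \<Phi> i p) a) l", OF frame_expand[OF A c p XY(2)]])
        also have "\<dots> = (\<Sum>j<brank A. \<Phi> p (Y p) j * \<Phi> p (T p (frame A \<Phi> i p) (frame A \<Phi> j p)) l)"
          by (subst linear_on_sum[OF l2 V]) (use i in \<open>auto intro: fr\<close>)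
        finally show "\<Phi> p (X p) i * \<Phi> p (T p (frame A \<Phi> i p) (Y p)) l = \<Phi> p (X p) i * (\<Sum>j<brank A. \<Phi> p (Y p) j * \<Phi> p (T p (frame A \<Phi> i p) (frame A \<Phi> j p)) l)" by simp
      qed
      finally show ?thesis by (simp add: sum_distrib_left)
    qed
    have a: "smooth_fun_on (base A) U (\<lambda>p. \<Phi> p (X p) i)" "smooth_fun_on (base A) U (\<lambda>p. \<Phi> p (Y p) i)" if "i < brank A" for i
      using c X Y that by (auto simp: sections_def)
    have b: "smooth_fun_on (base A) U (\<lambda>p. \<Phi> p (T p (frame A \<Phi> i p) (frame A \<Phi> j p)) l)" if "i < brank A" "j < brank A" for i j
      using c T l that unfolding bundle_valued_two_form_def by blast
    show ?thesis
      by (rule smooth_fun_on_cong[OF M U eq], assumption)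
         (auto intro!: smooth_fun_on_sum smooth_fun_on_mult M U a b)
  qed
  then show ?thesis using mem XY by (auto simp: sections_def)
qed

lemma half_leibniz:
  fixes y b s t :: "'v::real_vector"
  shows "(1/2) *\<^sub>R (f *\<^sub>R b + a *\<^sub>R y + (f *\<^sub>R s + a *\<^sub>R y)) + (1/2) *\<^sub>R f *\<^sub>R t =
    f *\<^sub>R ((1/2) *\<^sub>R (b + s) + (1/2) *\<^sub>R t) + a *\<^sub>R y" (is "?l = ?r + _")
proof -
  have "?l = ?r + (1/2) *\<^sub>R (a *\<^sub>R y + a *\<^sub>R y)"
    by (simp add: scaleR_add_right mult.commute add_ac)
  then show ?thesis by (simp only: scaleR_half_double)
qed

lemma half_torsion:
  fixes b s t :: "'v::real_vector"
  shows "(1/2) *\<^sub>R (b + s) + (1/2) *\<^sub>R t - ((1/2) *\<^sub>R (- b + s) + (1/2) *\<^sub>R (- t)) - b = t"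
    (is "?l = t")
proof -
  have "?l = (1/2) *\<^sub>R (b + b) + (1/2) *\<^sub>R (t + t) - b"
    unfolding scaleR_add_right scaleR_minus_right by (simp only: diff_conv_add_uminus minus_add minus_minus add_ac) simp
  then show ?thesis by (simp only: scaleR_half_double) simp
qed

(* The formula for D alone makes D an A-connection with torsion T. *)

lemma bracket_connection:
  assumes alg: "skew_symmetric_algebroid A \<rho> br" and sb: "symmetric_bracket A \<rho> sb"
    and T: "bundle_valued_two_form A T"
    and D: "\<And>X Y. X \<in> sections A \<Longrightarrow> Y \<in> sections A \<Longrightarrow>
      D X Y = (1/2) *\<^sub>R (br X Y + sb X Y) + (1/2) *\<^sub>R (\<lambda>p. T p (X p) (Y p))"
  shows "A_connection A \<rho> D"
    and "X \<in> sections A \<Longrightarrow> Y \<in> sections A \<Longrightarrow> torsion br D X Y = (\<lambda>p. T p (X p) (Y p))"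
proof -
  have A: "vector_bundle A" using alg by (simp add: skew_symmetric_algebroid_def anchored_bundle_def)
  have bb: "bilinear_on_sections A br" "bilinear_on_sections A sb"
    and lb: "leibniz_rule A \<rho> br" "leibniz_rule A \<rho> sb"
    and skb: "\<And>X Y. X \<in> sections A \<Longrightarrow> Y \<in> sections A \<Longrightarrow> br Y X = - br X Y"
    and syb: "\<And>X Y. X \<in> sections A \<Longrightarrow> Y \<in> sections A \<Longrightarrow> sb Y X = sb X Y"
    using alg sb unfolding skew_symmetric_algebroid_def symmetric_bracket_def by blast+
  have inf: "X p \<in> fibre A p" if "X \<in> sections A" for X p using that by (auto simp: sections_def)
  have skT: "T p b a = - T p a b" if "a \<in> fibre A p" "b \<in> fibre A p" for a b p
    using T that unfolding bundle_valued_two_form_def by blast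
  have lT: "linear_on (fibre A p) (T p a)" if "a \<in> fibre A p" for a p
    using T that by (auto simp: bundle_valued_two_form_def)
  have V: "subspace (fibre A p)" for p using A by (auto simp: vector_bundle_def)
  have T2: "T p a (b + b') = T p a b + T p a b'" "T p a (r *\<^sub>R b) = r *\<^sub>R T p a b"
    if "a \<in> fibre A p" "b \<in> fibre A p" "b' \<in> fibre A p" for p a b b' r
    using lT[OF that(1)] that by (auto simp: linear_on_def)
  have T1: "T p (b + b') a = T p b a + T p b' a" "T p (r *\<^sub>R b) a = r *\<^sub>R T p b a"
    if "a \<in> fibre A p" "b \<in> fibre A p" "b' \<in> fibre A p" for p a b b' r
    unfolding skT[OF that(1) subspace_add[OF V that(2,3)]] skT[OF that(1) subspace_scale[OF V that(2)]]
      skT[OF that(1,2)] skT[OF that(1,3)] T2[OF that] by simp_all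
  have clos: "br X Y \<in> sections A" "sb X Y \<in> sections A" if "X \<in> sections A" "Y \<in> sections A" for X Y
    using bb that by (auto simp: bilinear_on_sections_def)
  have br2: "br X (Y + Y') = br X Y + br X Y'" "br X (r *\<^sub>R Y) = r *\<^sub>R br X Y"
      "br (Y + Y') X = br Y X + br Y' X" "br (r *\<^sub>R Y) X = r *\<^sub>R br Y X"
      "sb X (Y + Y') = sb X Y + sb X Y'" "sb X (r *\<^sub>R Y) = r *\<^sub>R sb X Y"
      "sb (Y + Y') X = sb Y X + sb Y' X" "sb (r *\<^sub>R Y) X = r *\<^sub>R sb Y X"
    if "X \<in> sections A" "Y \<in> sections A" "Y' \<in> sections A" for X Y Y' r
  proof -
    have "linear_on (sections A) (br X)" "linear_on (sections A) (\<lambda>Y. br Y X)"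
         "linear_on (sections A) (sb X)" "linear_on (sections A) (\<lambda>Y. sb Y X)"
      using bb that(1) unfolding bilinear_on_sections_def by blast+
    note l = this[unfolded linear_on_def, THEN conjunct1, rule_format, OF that(2,3)]
      this[unfolded linear_on_def, THEN conjunct2, rule_format, OF that(2)]
    show "br X (Y + Y') = br X Y + br X Y'" "br X (r *\<^sub>R Y) = r *\<^sub>R br X Y"
      "br (Y + Y') X = br Y X + br Y' X" "br (r *\<^sub>R Y) X = r *\<^sub>R br Y X"
      "sb X (Y + Y') = sb X Y + sb X Y'" "sb X (r *\<^sub>R Y) = r *\<^sub>R sb X Y"
      "sb (Y + Y') X = sb Y X + sb Y' X" "sb (r *\<^sub>R Y) X = r *\<^sub>R sb Y X"
      by (fact l)+
  qed
  have L: "br X (f \<cdot> Y) = f \<cdot> br X Y + anchor_deriv \<rho> X f \<cdot> Y"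
          "sb X (f \<cdot> Y) = f \<cdot> sb X Y + anchor_deriv \<rho> X f \<cdot> Y"
    if "X \<in> sections A" "Y \<in> sections A" "f \<in> C_infinity (base A)" for X Y f
    using lb[unfolded leibniz_rule_def, rule_format, OF that] by this
  show "A_connection A \<rho> D"
    unfolding A_connection_def bilinear_on_sections_def leibniz_rule_def
  proof (intro conjI ballI)
    fix X Y assume X: "X \<in> sections A" and Y: "Y \<in> sections A"
    show "D X Y \<in> sections A"
      unfolding D[OF X Y]
      by (rule sections_add[OF A sections_scale[OF A sections_add[OF A clos[OF X Y]]]
                                 sections_scale[OF A two_form_sections[OF A T X Y]]])
    fix f assume f: "f \<in> C_infinity (base A)"
    have fX: "f \<cdot> X \<in> sections A" using sections_fmul[OF A X f] .
    have fY: "f \<cdot> Y \<in> sections A" using sections_fmul[OF A Y f] .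
    show "D (f \<cdot> X) Y = f \<cdot> D X Y"
    proof
      fix p
      have e1: "br (f \<cdot> X) Y p + sb (f \<cdot> X) Y p = f p *\<^sub>R (br X Y p + sb X Y p)"
        unfolding skb[OF Y fX] syb[OF Y fX] L[OF Y X f] skb[OF X Y] syb[OF X Y]
        by (simp add: fmul_def scaleR_add_right)
      have e2: "T p ((f \<cdot> X) p) (Y p) = f p *\<^sub>R T p (X p) (Y p)"
        unfolding fmul_def by (rule T1(2)[OF inf[OF Y] inf[OF X] inf[OF X]])
      show "D (f \<cdot> X) Y p = (f \<cdot> D X Y) p"
        unfolding D[OF fX Y] D[OF X Y] scaleR_fun_def plus_fun_apply e1 e2
        by (simp add: fmul_def scaleR_add_right)
    qed
    show "D X (f \<cdot> Y) = f \<cdot> D X Y + anchor_deriv \<rho> X f \<cdot> Y"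
    proof
      fix p
      have "T p (X p) ((f \<cdot> Y) p) = f p *\<^sub>R T p (X p) (Y p)"
        unfolding fmul_def by (rule T2(2)[OF inf[OF X] inf[OF Y] inf[OF Y]])
      then show "D X (f \<cdot> Y) p = (f \<cdot> D X Y + anchor_deriv \<rho> X f \<cdot> Y) p"
        unfolding D[OF X fY] D[OF X Y] L[OF X Y f]
        by (simp only: fmul_def scaleR_fun_def plus_fun_apply half_leibniz)
    qed
  next
    fix X assume X: "X \<in> sections A"
    note add = sections_add[OF A] and scale = sections_scale[OF A]
    show "linear_on (sections A) (D X)"
      unfolding linear_on_def
    proof (intro conjI ballI allI)
      fix Y Z assume Y: "Y \<in> sections A" and Z: "Z \<in> sections A"
      show "D X (Y + Z) = D X Y + D X Z"
        unfolding D[OF X Y] D[OF X Z] D[OF X add[OF Y Z]] br2[OF X Y Z]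
        by (rule ext) (simp add: T2(1)[OF inf[OF X] inf[OF Y] inf[OF Z]] scaleR_fun_def scaleR_add_right add_ac)
    next
      fix Y r assume Y: "Y \<in> sections A"
      show "D X (r *\<^sub>R Y) = r *\<^sub>R D X Y"
        unfolding D[OF X Y] D[OF X scale[OF Y]] br2[OF X Y Y]
        by (rule ext) (simp add: T2(2)[OF inf[OF X] inf[OF Y] inf[OF Y]] scaleR_fun_def scaleR_add_right mult.commute)
    qed
    show "linear_on (sections A) (\<lambda>Y. D Y X)"
      unfolding linear_on_def
    proof (intro conjI ballI allI)
      fix Y Z assume Y: "Y \<in> sections A" and Z: "Z \<in> sections A"
      show "D (Y + Z) X = D Y X + D Z X"
        unfolding D[OF Y X] D[OF Z X] D[OF add[OF Y Z] X] br2[OF X Y Z]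
        by (rule ext) (simp add: T1(1)[OF inf[OF X] inf[OF Y] inf[OF Z]] scaleR_fun_def scaleR_add_right add_ac)
    next
      fix Y r assume Y: "Y \<in> sections A"
      show "D (r *\<^sub>R Y) X = r *\<^sub>R D Y X"
        unfolding D[OF Y X] D[OF scale[OF Y] X] br2[OF X Y Y]
        by (rule ext) (simp add: T1(2)[OF inf[OF X] inf[OF Y] inf[OF Y]] scaleR_fun_def scaleR_add_right mult.commute)
    qed
  qed
  show "torsion br D X Y = (\<lambda>p. T p (X p) (Y p))"
    if X: "X \<in> sections A" and Y: "Y \<in> sections A"
  proof
    fix p
    show "torsion br D X Y p = T p (X p) (Y p)"
      unfolding torsion_def D[OF X Y] D[OF Y X] skb[OF X Y] syb[OF X Y]
      by (simp only: scaleR_fun_def plus_fun_apply minus_apply uminus_apply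
                     skT[OF inf[OF X] inf[OF Y]] half_torsion)
  qed
qed

end

theory Submission
  imports Defs
begin

text \<open>
  The connection is half the sum of \<open>[X, Y]\<close>, \<open>\<langle>X : Y\<rangle>\<close> and \<open>T(X, Y)\<close>, and
  both Lie derivatives of \<open>g\<close> and \<open>\<nabla>g\<close> arise by the same formula from \<open>[\<cdot>, \<cdot>]\<close>,
  \<open>\<langle>\<cdot> : \<cdot>\<rangle>\<close> and \<open>\<nabla>\<close>. Each of the two Lie derivatives contributes one copy of the anchor term,
  which together match the two copies in \<open>2 \<nabla>g\<close>; so, for all sections,
  \<open>2 (\<nabla>g)(X, Y, Z) = (\<L>\<^sup>a\<^sub>X g)(Y, Z) + (\<L>\<^sup>s\<^sub>X g)(Y, Z) - (g(T(X, Y), Z) + g(Y, T(X, Z)))\<close>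
  (lemma \<open>double_cov_deriv_metric\<close>). By symmetry of \<open>g\<close>, the term in parentheses
  adds the values of \<open>g(T(\<cdot>, \<cdot>), \<cdot>)\<close> at \<open>(X, Y, Z)\<close> and \<open>(X, Z, Y)\<close>. It vanishes when the torsion is totally skew-symmetric
  (lemma \<open>totally_skew_symmetric_cancel\<close>), and then \<open>\<nabla>g\<close> is half the sum of the two Lie derivatives.
\<close>

lemma sections_in_fibre: "X \<in> sections A \<Longrightarrow> X p \<in> fibre A p"
  by (simp add: sections_def)

lemma metric_sym:
  assumes "pseudo_riemannian_metric A g" and "a \<in> fibre A p" and "b \<in> fibre A p"
  shows "g p a b = g p b a"
  using assms unfolding pseudo_riemannian_metric_def by blast

lemma metric_half_sum:
  assumes A: "vector_bundle A" and g: "pseudo_riemannian_metric A g"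
    and b: "b \<in> fibre A p" and s: "s \<in> fibre A p" and t: "t \<in> fibre A p" and c: "c \<in> fibre A p"
  shows "2 * g p c ((1/2) *\<^sub>R (b + s) + (1/2) *\<^sub>R t) = g p c b + g p c s + g p c t"
    and "2 * g p ((1/2) *\<^sub>R (b + s) + (1/2) *\<^sub>R t) c = g p b c + g p s c + g p t c"
proof -
  have V: "subspace (fibre A p)" using A by (simp add: vector_bundle_def)
  have "linear_on (fibre A p) (g p c)"
    using g c by (simp add: pseudo_riemannian_metric_def)
  then have add: "\<And>x y. x \<in> fibre A p \<Longrightarrow> y \<in> fibre A p \<Longrightarrow> g p c (x + y) = g p c x + g p c y"
    and scale: "\<And>r x. x \<in> fibre A p \<Longrightarrow> g p c (r *\<^sub>R x) = r * g p c x"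
    by (auto simp: linear_on_def)
  have bs: "b + s \<in> fibre A p" using subspace_add[OF V b s] .
  note half = subspace_scale[OF V bs, of "1/2"] subspace_scale[OF V t, of "1/2"]
  have mem: "(1/2) *\<^sub>R (b + s) + (1/2) *\<^sub>R t \<in> fibre A p"
    using subspace_add[OF V half] .
  show right: "2 * g p c ((1/2) *\<^sub>R (b + s) + (1/2) *\<^sub>R t) = g p c b + g p c s + g p c t"
    unfolding add[OF half] scale[OF bs] scale[OF t] add[OF b s] by simp
  show "2 * g p ((1/2) *\<^sub>R (b + s) + (1/2) *\<^sub>R t) c = g p b c + g p s c + g p t c"
    using right
    unfolding metric_sym[OF g c mem] metric_sym[OF g c b] metric_sym[OF g c s] metric_sym[OF g c t] .
qed

text \<open>
  Total skew-symmetry in the form in which it meets \<open>\<nabla>g\<close>: for fixed \<open>X\<close> the endomorphism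
  \<open>\<tau>(X, \<cdot>)\<close> is skew-adjoint for \<open>g\<close>.
\<close>

lemma totally_skew_symmetric_cancel:
  assumes g: "pseudo_riemannian_metric A g" and skew: "totally_skew_symmetric A g \<tau>"
    and X: "X \<in> sections A" and Y: "Y \<in> sections A" and Z: "Z \<in> sections A"
    and mem: "\<tau> X Z p \<in> fibre A p"
  shows "g p (\<tau> X Y p) (Z p) + g p (Y p) (\<tau> X Z p) = 0"
proof -
  obtain \<omega> where \<omega>: "three_form A \<omega>"
    and val: "\<And>X Y Z. X \<in> sections A \<Longrightarrow> Y \<in> sections A \<Longrightarrow> Z \<in> sections A \<Longrightarrow>
      g p (\<tau> X Y p) (Z p) = \<omega> p (X p) (Y p) (Z p)"
    using skew unfolding totally_skew_symmetric_def by blast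
  have alt: "\<omega> p a c b = - \<omega> p a b c"
    if "a \<in> fibre A p" "b \<in> fibre A p" "c \<in> fibre A p" for a b c
    using \<omega>[unfolded three_form_def, THEN conjunct2, THEN conjunct1] that by blast
  have "g p (Y p) (\<tau> X Z p) = \<omega> p (X p) (Z p) (Y p)"
    using metric_sym[OF g mem sections_in_fibre[OF Y]] val[OF X Z Y] by simp
  also have "\<dots> = - \<omega> p (X p) (Y p) (Z p)"
    by (rule alt[OF sections_in_fibre[OF X] sections_in_fibre[OF Y] sections_in_fibre[OF Z]])
  finally show ?thesis using val[OF X Y Z] by simp
qed

text \<open>
  Bilinearity of \<open>g\<close>, applied pointwise to the terms \<open>g(\<nabla>\<^sub>X Y, Z)\<close> and \<open>g(Y, \<nabla>\<^sub>X Z)\<close> of \<open>\<nabla>g\<close>.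
  The identity holds for every two-form \<open>T\<close> and so isolates what total skew-symmetry must cancel.
\<close>

lemma double_cov_deriv_metric:
  assumes A: "vector_bundle A" and g: "pseudo_riemannian_metric A g"
    and br: "bilinear_on_sections A br" and sb: "bilinear_on_sections A sb"
    and T: "bundle_valued_two_form A T"
    and D: "\<And>X Y. X \<in> sections A \<Longrightarrow> Y \<in> sections A \<Longrightarrow>
      D X Y = (1/2) *\<^sub>R (br X Y + sb X Y) + (1/2) *\<^sub>R (\<lambda>p. T p (X p) (Y p))"
    and X: "X \<in> sections A" and Y: "Y \<in> sections A" and Z: "Z \<in> sections A"
  shows "2 * cov_deriv_metric \<rho> D g X Y Z p =
    alt_lie_deriv \<rho> br X g Y Z p + sym_lie_deriv \<rho> sb X g Y Z p
      - (g p (T p (X p) (Y p)) (Z p) + g p (Y p) (T p (X p) (Z p)))"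
proof -
  have mem: "br X W p \<in> fibre A p" "sb X W p \<in> fibre A p" "T p (X p) (W p) \<in> fibre A p"
    if W: "W \<in> sections A" for W
    using br sb X W sections_in_fibre[OF two_form_sections[OF A T X W]]
    by (auto simp: bilinear_on_sections_def sections_in_fibre)
  have Dp: "D X W p = (1/2) *\<^sub>R (br X W p + sb X W p) + (1/2) *\<^sub>R T p (X p) (W p)"
    if "W \<in> sections A" for W
    using D[OF X that] by (simp add: scaleR_fun_def)
  have YZ: "2 * g p (D X Y p) (Z p) =
      g p (br X Y p) (Z p) + g p (sb X Y p) (Z p) + g p (T p (X p) (Y p)) (Z p)"
    unfolding Dp[OF Y] by (rule metric_half_sum(2)[OF A g mem[OF Y] sections_in_fibre[OF Z]])
  have ZY: "2 * g p (Y p) (D X Z p) =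
      g p (Y p) (br X Z p) + g p (Y p) (sb X Z p) + g p (Y p) (T p (X p) (Z p))"
    unfolding Dp[OF Z] by (rule metric_half_sum(1)[OF A g mem[OF Z] sections_in_fibre[OF Y]])
  have "2 * (a - x - y) = (a - b - b') + (a - s - s') - (t + t')"
    if "2 * x = b + s + t" and "2 * y = b' + s' + t'" for a x y b b' s s' t t' :: real
    using that by algebra
  from this[OF YZ ZY] show ?thesis
    unfolding cov_deriv_metric_def alt_lie_deriv_def sym_lie_deriv_def .
qed

theorem corollary5p2:
  fixes A :: "('m::{t2_space, second_countable_topology}, 'v::real_vector) vbundle"
    and \<rho> :: "'m \<Rightarrow> 'v \<Rightarrow> ('m \<Rightarrow> real) \<Rightarrow> real"
    and br sb D :: "('m, 'v) operation"
    and g :: "'m \<Rightarrow> 'v \<Rightarrow> 'v \<Rightarrow> real"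
    and T :: "'m \<Rightarrow> 'v \<Rightarrow> 'v \<Rightarrow> 'v"
  assumes "skew_symmetric_algebroid A \<rho> br"
    and "pseudo_riemannian_metric A g"
    and "symmetric_bracket A \<rho> sb"
    and "bundle_valued_two_form A T"
    and "A_connection A \<rho> D"
    and "\<forall>X\<in>sections A. \<forall>Y\<in>sections A.
           D X Y = (1/2) *\<^sub>R (br X Y + sb X Y) + (1/2) *\<^sub>R (\<lambda>p. T p (X p) (Y p))"
    and "totally_skew_symmetric A g (torsion br D)"
  shows "metric_connection A \<rho> g D \<longleftrightarrow>
    (\<forall>X\<in>sections A. \<forall>Y\<in>sections A. \<forall>Z\<in>sections A.
        alt_lie_deriv \<rho> br X g Y Z = - sym_lie_deriv \<rho> sb X g Y Z)"
proof -
  have A: "vector_bundle A" and br: "bilinear_on_sections A br"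
    using assms(1) by (simp_all add: skew_symmetric_algebroid_def anchored_bundle_def)
  have sb: "bilinear_on_sections A sb"
    using assms(3) by (simp add: symmetric_bracket_def)
  note D = assms(6)[rule_format]
  have torsion: "torsion br D X Y = (\<lambda>p. T p (X p) (Y p))"
    if "X \<in> sections A" "Y \<in> sections A" for X Y
    by (rule bracket_connection(2)[OF assms(1,3,4) _ that]) (rule D)
  have double: "2 * cov_deriv_metric \<rho> D g X Y Z p =
      alt_lie_deriv \<rho> br X g Y Z p + sym_lie_deriv \<rho> sb X g Y Z p"
    if X: "X \<in> sections A" and Y: "Y \<in> sections A" and Z: "Z \<in> sections A" for X Y Z p
  proof -
    have mem: "torsion br D X Z p \<in> fibre A p"
      unfolding torsion[OF X Z] using sections_in_fibre[OF two_form_sections[OF A assms(4) X Z]] .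
    have cancel: "g p (T p (X p) (Y p)) (Z p) + g p (Y p) (T p (X p) (Z p)) = 0"
      using totally_skew_symmetric_cancel[OF assms(2,7) X Y Z mem] unfolding torsion[OF X Y] torsion[OF X Z] .
    have "2 * cov_deriv_metric \<rho> D g X Y Z p =
        alt_lie_deriv \<rho> br X g Y Z p + sym_lie_deriv \<rho> sb X g Y Z p
          - (g p (T p (X p) (Y p)) (Z p) + g p (Y p) (T p (X p) (Z p)))"
      by (rule double_cov_deriv_metric[OF A assms(2) br sb assms(4) _ X Y Z]) (rule D)
    then show ?thesis unfolding cancel by simp
  qed
  have "cov_deriv_metric \<rho> D g X Y Z = 0 \<longleftrightarrow>
      alt_lie_deriv \<rho> br X g Y Z = - sym_lie_deriv \<rho> sb X g Y Z"
    if "X \<in> sections A" "Y \<in> sections A" "Z \<in> sections A" for X Y Z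
  proof -
    have "cov_deriv_metric \<rho> D g X Y Z p = 0 \<longleftrightarrow>
        alt_lie_deriv \<rho> br X g Y Z p = - sym_lie_deriv \<rho> sb X g Y Z p" for p
      using double[OF that, of p] by linarith
    then show ?thesis unfolding fun_eq_iff by simp
  qed
  then show ?thesis unfolding metric_connection_def by blast
qed

end
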